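(* Let $\ell\in\{0,2\}$, $g\in E_\ell\cap W(\mathbb{R})$, and let $s>0$ with $s^2\in\{2,3\}$. Then for every $\lambda>0$, $$Z_{s\lambda}g\left(\frac{\tfrac12+p}{s^2},\tfrac12\right)=(-1)^{\lfloor \ell/2\rfloor}\,Z_{s/\lambda}g\left(\frac{\tfrac12+p}{s^2},\tfrac12\right)\quad\text{for all } p=0,1,\dots,s^2-1.$$ In case $s^2=2$, this identity also holds for $\ell\in\{1,3\}$ and $g\in E_\ell\cap W(\mathbb{R})$.
   Context: The Fourier transform is $\hat f(\gamma)=\int_{\mathbb{R}}f(x)e^{-2\pi i\gamma x}\,dx$ for $f \in L^1(\mathbb{R})$, extended to $L^2(\mathbb{R})$. For $\ell=0,1,2,3$, $E_\ell\subset L^2(\mathbb{R})$ is the eigenspace of the Fourier transform with eigenvalue $(-i)^\ell$, i.e. the closed span of the Hermite functions $h_{4m+\ell}$, $m\in\mathbb{Z}_{\ge0}$, where $h_n(x)=(-1)^nc_n^{-1/2}e^{\pi x^2}\frac{d^n}{dx^n}e^{-2\pi x^2}$ with $c_n=(2\pi)^n2^{n-1/2}n!$. The Wiener space $W(\mathbb{R})$ consists of all $g\in L^\infty(\mathbb{R})$ with $\sum_{k\in\mathbb{Z}}\operatorname{ess\,sup}_{x\in[0,1]}|g(x+k)|<\infty$. An element $g$ of $E_\ell\cap W(\mathbb{R})$ satisfies $g,\hat g\in W(\mathbb{R})\subset L^1(\mathbb{R})$ and is identified with its continuous representative. For $\lambda>0$ the Zak transform is $Z_\lambda f(x,\gamma)=\sqrt{\lambda}\sum_{k\in\mathbb{Z}}f(\lambda(x+k))e^{-2\pi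 ik\gamma}$, $x,\gamma\in\mathbb{R}$. *)

theory Defs
  imports "HOL-Probability.Essential_Supremum"
begin

text \<open>Elements of the spaces below are represented by functions on the real line that are
  Borel measurable (every class of Lebesgue measurable functions contains one).\<close>

definition L1 :: "(real \<Rightarrow> complex) set" where
  "L1 = {f. integrable lborel f}"

definition L2 :: "(real \<Rightarrow> complex) set" where
  "L2 = {f. f \<in> borel_measurable lborel \<and> integrable lborel (\<lambda>x. (cmod (f x))\<^sup>2)}"

definition L2_tendsto :: "(nat \<Rightarrow> real \<Rightarrow> complex) \<Rightarrow> (real \<Rightarrow> complex) \<Rightarrow> bool" where
  "L2_tendsto u f \<longleftrightarrow> (\<lambda>n. \<integral>\<^sup>+x. ennreal ((cmod (u n x - f x))\<^sup>2) \<partial>lborel) \<longlonglongrightarrow> 0"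

definition fourier :: "(real \<Rightarrow> complex) \<Rightarrow> real \<Rightarrow> complex" where
  "fourier f \<gamma> = (LINT x|lborel. f x * exp (- 2 * of_real pi * \<i> * of_real \<gamma> * of_real x))"

text \<open>The extension of the Fourier transform to \<open>L\<^sup>2\<close> by continuity, as a relation because its values
  are determined only almost everywhere: its graph is the closure in \<open>L\<^sup>2 \<times> L\<^sup>2\<close> of the graph of
  the integral transform on \<open>L\<^sup>1 \<inter> L\<^sup>2\<close>.\<close>

definition is_fourier_L2 :: "(real \<Rightarrow> complex) \<Rightarrow> (real \<Rightarrow> complex) \<Rightarrow> bool" where
  "is_fourier_L2 f F \<longleftrightarrow> f \<in> L2 \<and> F \<in> L2 \<and>
     (\<exists>u. (\<forall>n. u n \<in> L1 \<inter> L2) \<and> L2_tendsto u f \<and> L2_tendsto (\<lambda>n. fourier (u n)) F)"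

definition fourier_eigenspace :: "nat \<Rightarrow> (real \<Rightarrow> complex) set" where
  "fourier_eigenspace l = {f. is_fourier_L2 f (\<lambda>x. (- \<i>) ^ l * f x)}"

definition wiener_space :: "(real \<Rightarrow> complex) set" where
  "wiener_space = {g. g \<in> borel_measurable lborel \<and>
     esssup lborel (\<lambda>x. ennreal (cmod (g x))) < \<infinity> \<and>
     (\<Sum>\<^sub>\<infinity>k::int. esssup (restrict_space lborel {0..1}) (\<lambda>x. ennreal (cmod (g (x + of_int k))))) < \<infinity>}"

text \<open>For continuous functions in the Wiener space the series converges absolutely at every point.\<close>

definition zak :: "real \<Rightarrow> (real \<Rightarrow> complex) \<Rightarrow> real \<Rightarrow> real \<Rightarrow> complex" where
  "zak a f x \<gamma> = of_real (sqrt a) *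
     (\<Sum>\<^sub>\<infinity>k::int. f (a * (x + of_int k)) * exp (- 2 * of_real pi * \<i> * of_int k * of_real \<gamma>))"

end

theory Submission
  imports Defs "HOL-Probability.Sinc_Integral"
begin

text \<open>
  Three symmetries of the Zak transform force the identity. Write \<open>Z a x \<gamma>\<close> for
  \<^term>\<open>zak a g x \<gamma>\<close>.

  First, Poisson summation turns the Zak transform of \<open>g\<close> into the Zak transform of its Fourier
  transform (lemma \<open>zak_fourier\<close>). For an eigenfunction with eigenvalue \<open>(-\<i>)\<^sup>l\<close> this reads
  \<open>Z a x \<gamma> = (-\<i>)\<^sup>l e(x \<gamma>) Z (1/a) \<gamma> (-x)\<close> with \<open>e(t) = exp (2 \<pi> \<i> t)\<close>. Applying it twice gives
  \<open>Z a x \<gamma> = (-1)\<^sup>l Z a (-x) (-\<gamma>)\<close>. This is the parity of \<open>g\<close> (an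
  eigenfunction is even or odd along with \<open>l\<close>), seen on the Zak side.

  Second, let \<open>s\<^sup>2 = n\<close> be an integer and put \<open>x\<^sub>p = (1/2 + p) / n\<close>. Sorting the Zak series at scale
  \<open>1 / (s a)\<close> by the residue of the summation index modulo \<open>n\<close> (lemma \<open>zak_decimation\<close>) yields
  Zak series at scale \<open>s / a\<close>. Hence the vector of the values \<open>Z (s a) x\<^sub>p (1/2)\<close>, \<open>p < n\<close>, is
  \<open>(-\<i>)\<^sup>l / s\<close> times the matrix \<open>e((1/2 + q) (1/2 + p) / n)\<close> applied to the vector of the
  values \<open>Z (s / a) x\<^sub>q (1/2)\<close> (lemma \<open>zak_eigenfunction_finite_transform\<close>).

  Third, parity and quasi-periodicity give \<open>Z b (1 - x) (1/2) = - (-1)\<^sup>l Z b x (1/2)\<close>, and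
  \<open>1 - x\<^sub>p = x\<^sub>r\<close> with \<open>r = n - 1 - p\<close>. For \<open>n = 2\<close>, and for \<open>n = 3\<close> with even \<open>l\<close> (where the middle entry
  vanishes), the vectors are therefore confined to a line, and the matrix acts on this line as a
  scalar. That scalar is the sign \<open>(-1)\<close> to the power \<open>l div 2\<close>.

  Two analytic facts support this. The Poisson summation formula is proved by comparing the Fourier
  coefficients of the two sides, the uniqueness of Fourier coefficients coming from the Fejer
  kernel. And the eigenvalue equation, given for the Fourier transform on \<open>L\<^sup>2\<close>, is shown to hold at
  every point for the Fourier integral (lemma \<open>fourier_eq_L2_fourier\<close>), by testing against
  indicators of intervals and using the multiplication formula.
\<close>

section \<open>The Fejer kernel and uniqueness of Fourier coefficients\<close>

lemma integral_cis:
  fixes m :: int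
  shows "((\<lambda>t. cis (2 * pi * of_int m * t)) has_integral (if m = 0 then 1 else 0)) {-1/2..1/2}"
proof (cases "m = 0")
  case True
  then show ?thesis
    using has_integral_const_real[of "1::complex" "-1/2" "1/2"] by simp
next
  case False
  define c where "c = 2 * pi * of_int m"
  have c: "c \<noteq> 0" using False by (simp add: c_def)
  have "((\<lambda>t. exp (\<i> * of_real (c * t)) / (\<i> * of_real c)) has_vector_derivative exp (\<i> * of_real (c * t)))
          (at t within {-1/2..1/2})" for t
    using c by (auto intro!: derivative_eq_intros has_vector_derivative_real_field simp: field_simps)
  then have "((\<lambda>t. exp (\<i> * of_real (c * t))) has_integral
      (exp (\<i> * of_real (c * (1/2))) / (\<i> * of_real c) - exp (\<i> * of_real (c * (-1/2))) / (\<i> * of_real c))) {-1/2..1/2}"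
    by (intro fundamental_theorem_of_calculus) auto
  moreover have "exp (\<i> * of_real (c * (1/2))) = exp (\<i> * of_real (c * (-1/2)))"
  proof -
    have "exp (\<i> * of_real (c * (1/2))) = exp (\<i> * of_real (c * (-1/2))) * cis (2 * pi * of_int m)"
      by (simp add: cis_conv_exp c_def flip: exp_add) (simp add: field_simps)
    then show ?thesis by simp
  qed
  ultimately show ?thesis using False by (simp add: cis_conv_exp c_def)
qed

text \<open>Expanded into a double sum of characters, its integral against a function is
  visibly a combination of Fourier coefficients; the closed form \<open>fejer_eq\<close> shows that it is
  nonnegative.\<close>

definition fejer :: "nat \<Rightarrow> real \<Rightarrow> complex" where
  "fejer N t = (\<Sum>j<N. \<Sum>k<N. cis (2 * pi * of_int (int j - int k) * t)) / of_nat N"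

lemma fejer_eq: "fejer N t = of_real ((cmod (\<Sum>j<N. cis (2 * pi * t) ^ j))\<^sup>2 / real N)"
proof -
  have "(\<Sum>j<N. cis (2 * pi * t) ^ j) * cnj (\<Sum>j<N. cis (2 * pi * t) ^ j) =
     (\<Sum>j<N. \<Sum>k<N. cis (2 * pi * of_int (int j - int k) * t))"
    by (simp add: sum_product Complex.DeMoivre cis_cnj cis_mult algebra_simps)
  then show ?thesis
    by (simp only: fejer_def of_real_divide complex_norm_square of_real_of_nat_eq)
qed

lemma norm_fejer: "cmod (fejer N t) = (cmod (\<Sum>j<N. cis (2 * pi * t) ^ j))\<^sup>2 / real N"
  unfolding fejer_eq norm_of_real by simp

text \<open>Away from \<open>0\<close> the geometric sum is bounded by \<open>2 / \<bar>z - 1\<bar>\<close>, where \<open>z = cis (2 \<pi> t)\<close> and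
  \<open>\<bar>z - 1\<bar>\<^sup>2 = 2 (1 - cos (2 \<pi> t))\<close>, so the kernel decays like \<open>1 / N\<close> there.\<close>

lemma fejer_le:
  assumes "0 < \<delta>" "\<delta> \<le> \<bar>t\<bar>" "\<bar>t\<bar> \<le> 1/2"
  shows "cmod (fejer N t) \<le> 2 / (1 - cos (2 * pi * \<delta>)) / real N"
proof -
  define z where "z = cis (2 * pi * t)"
  have "cos (2 * pi * t) = cos (2 * pi * \<bar>t\<bar>)" by (auto simp: abs_if)
  also have "\<dots> \<le> cos (2 * pi * \<delta>)"
    using assms pi_gt_zero by (intro cos_monotone_0_pi_le) (auto simp: field_simps)
  finally have le: "cos (2 * pi * t) \<le> cos (2 * pi * \<delta>)" .
  have "cos (2 * pi * \<delta>) < cos 0"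
    using assms pi_gt_zero by (intro cos_monotone_0_pi) (auto simp: field_simps)
  then have pos: "1 - cos (2 * pi * \<delta>) > 0" by simp
  have "(cmod (z - 1))\<^sup>2 = 2 * (1 - cos (2 * pi * t))"
    using sin_cos_squared_add[of "2 * pi * t"]
    by (simp add: z_def cmod_power2) (simp add: power2_eq_square algebra_simps)
  with le have z1: "(cmod (z - 1))\<^sup>2 \<ge> 2 * (1 - cos (2 * pi * \<delta>))" by simp
  then have "z \<noteq> 1" using pos by auto
  then have "(\<Sum>j<N. z ^ j) = (z ^ N - 1) / (z - 1)" by (simp add: geometric_sum)
  moreover have "cmod (z ^ N - 1) \<le> 2"
    using norm_triangle_ineq4[of "z ^ N" 1] by (simp add: z_def norm_power)
  ultimately have "(cmod (\<Sum>j<N. z ^ j))\<^sup>2 \<le> 2\<^sup>2 / (cmod (z - 1))\<^sup>2"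
    by (simp only: norm_divide power_divide) (intro divide_right_mono power_mono; simp)
  also have "\<dots> \<le> 4 / (2 * (1 - cos (2 * pi * \<delta>)))"
    using z1 pos by (intro frac_le) auto
  also have "\<dots> = 2 / (1 - cos (2 * pi * \<delta>))"
    using pos by (simp add: field_simps)
  finally have "(cmod (\<Sum>j<N. z ^ j))\<^sup>2 \<le> 2 / (1 - cos (2 * pi * \<delta>))" .
  then show ?thesis
    unfolding norm_fejer z_def[symmetric] by (rule divide_right_mono) simp
qed

text \<open>All integrals of \<open>f\<close> against Fejer kernels vanish, while these kernels are nonnegative, have
  integral \<open>1\<close> and concentrate at \<open>0\<close>; hence \<open>f 0\<close> is a limit of such integrals.\<close>

lemma zero_if_Fourier_coefficients_zero:
  fixes f :: "real \<Rightarrow> complex"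
  assumes cont: "continuous_on {-1/2..1/2} f"
    and zero: "\<And>m::int. integral {-1/2..1/2} (\<lambda>t. f t * cis (2 * pi * of_int m * t)) = 0"
  shows "f 0 = 0"
proof -
  let ?I = "{-1/2..1/2::real}"
  have cont_fejer: "continuous_on ?I (fejer N)" for N
    unfolding fejer_def divide_inverse by (intro continuous_intros)
  have f0: "((\<lambda>t. f t * fejer N t) has_integral 0) ?I" for N
  proof -
    have "((\<lambda>t. f t * cis (2 * pi * of_int m * t)) has_integral 0) ?I" for m :: int
    proof -
      have "continuous_on ?I (\<lambda>t. f t * cis (2 * pi * of_int m * t))"
        by (intro continuous_intros cont)
      then show ?thesis
        using zero[of m] integrable_continuous_real integrable_integral by metis
    qed
    then have "((\<lambda>t. (\<Sum>j<N. \<Sum>k<N. f t * cis (2 * pi * of_int (int j - int k) * t)) / of_nat N)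
        has_integral ((\<Sum>j<N. \<Sum>k<N. 0) / of_nat N)) ?I"
      by (intro has_integral_divide has_integral_sum) (auto simp del: of_int_diff)
    then show ?thesis by (simp add: fejer_def sum_distrib_left)
  qed
  have one: "(fejer N has_integral 1) ?I" if "N > 0" for N
  proof -
    have "((\<lambda>t. (\<Sum>j<N. \<Sum>k<N. cis (2 * pi * of_int (int j - int k) * t)) / of_nat N)
        has_integral ((\<Sum>j<N. \<Sum>k<N. if int j - int k = 0 then 1 else 0) / of_nat N)) ?I"
      by (intro has_integral_divide has_integral_sum integral_cis) auto
    then show ?thesis using that by (simp add: fejer_def[abs_def])
  qed
  obtain M where M: "\<And>t. t \<in> ?I \<Longrightarrow> cmod (f t) \<le> M"
    using compact_imp_bounded[OF compact_continuous_image[OF cont compact_Icc]]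
    by (metis bounded_iff imageI)
  have "cmod (f 0) \<le> e" if e: "e > 0" for e
  proof -
    have "\<exists>\<delta>>0. \<forall>t\<in>?I. dist t 0 < \<delta> \<longrightarrow> dist (f t) (f 0) < e"
      using cont[unfolded continuous_on_iff, rule_format, of 0 e] e by simp
    then obtain \<delta> where \<delta>: "\<delta> > 0" "\<And>t. t \<in> ?I \<Longrightarrow> \<bar>t\<bar> < \<delta> \<Longrightarrow> cmod (f t - f 0) \<le> e"
      by (auto simp: dist_norm less_imp_le)
    \<comment> \<open>the deviation of \<open>f\<close> from \<open>f 0\<close> is at most \<open>e\<close> near \<open>0\<close> and at most \<open>2 M\<close> elsewhere, where the kernel is small\<close>
    define C where "C = 2 * M * (2 / (1 - cos (2 * pi * \<delta>)))"
    have bound: "cmod (f 0) \<le> e + C / real N" if N: "N > 0" for N :: nat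
    proof -
      have re: "((\<lambda>t. Re (fejer N t)) has_integral 1) ?I"
        using has_integral_Re[OF one[OF N]] by simp
      have ub: "((\<lambda>t. e * Re (fejer N t) + C / real N) has_integral (e * 1 + C / real N)) ?I"
        using has_integral_add[OF has_integral_mult_right[OF re, of e] has_integral_const_real[of "C / real N" "-1/2" "1/2"]]
        by simp
      have int: "((\<lambda>t. (f 0 - f t) * fejer N t) has_integral f 0) ?I"
        using has_integral_diff[OF has_integral_mult_right[OF one[OF N], of "f 0"] f0[of N]]
        by (simp add: algebra_simps)
      have "cmod ((f 0 - f t) * fejer N t) \<le> e * Re (fejer N t) + C / real N" if t: "t \<in> ?I" for t
      proof -
        have Re_nonneg: "cmod (fejer N t) = Re (fejer N t)" "Re (fejer N t) \<ge> 0"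
          unfolding norm_fejer by (simp_all only: fejer_eq Re_complex_of_real) simp
        have M0: "M \<ge> 0" using M[OF t] norm_ge_zero order_trans by blast
        show ?thesis
        proof (cases "\<bar>t\<bar> < \<delta>")
          case True
          have "1 - cos (2 * pi * \<delta>) \<ge> 0" by simp
          then have "C / real N \<ge> 0" using M0 by (simp add: C_def)
          moreover have "cmod (f 0 - f t) * cmod (fejer N t) \<le> e * Re (fejer N t)"
            using \<delta>(2)[OF t True] Re_nonneg by (simp add: mult_right_mono norm_minus_commute)
          ultimately show ?thesis by (simp add: norm_mult)
        next
          case False
          have "cmod (f 0 - f t) \<le> 2 * M"
            using norm_triangle_ineq4[of "f 0" "f t"] M[OF t] M[of 0] by simp
          then have "cmod (f 0 - f t) * cmod (fejer N t) \<le> 2 * M * (2 / (1 - cos (2 * pi * \<delta>)) / real N)"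
            using False t \<delta>(1) M0 by (intro mult_mono fejer_le) auto
          moreover have "e * Re (fejer N t) \<ge> 0" using e Re_nonneg by simp
          ultimately show ?thesis by (simp add: norm_mult C_def)
        qed
      qed
      then have "norm (integral ?I (\<lambda>t. (f 0 - f t) * fejer N t)) \<le> integral ?I (\<lambda>t. e * Re (fejer N t) + C / real N)"
        using int ub by (intro integral_norm_bound_integral) (auto intro: has_integral_integrable)
      then show ?thesis using int ub by (simp add: integral_unique)
    qed
    have lim: "(\<lambda>N. e + C / real N) \<longlonglongrightarrow> e + 0"
      by (intro tendsto_intros lim_const_over_n)
    have "\<forall>N\<ge>1. cmod (f 0) \<le> e + C / real N"
      by (intro allI impI bound) simp
    from Lim_bounded2[OF lim this] show ?thesis by simp
  qed
  then have "cmod (f 0) \<le> 0 + e" if "e > 0" for e using that by simp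
  then have "cmod (f 0) \<le> 0" by (rule field_le_epsilon)
  then show ?thesis by simp
qed

section \<open>The Poisson summation formula\<close>

text \<open>Termwise integration of a series of continuous functions that converges uniformly by the
  Weierstrass M-test, for an unordered index set.\<close>

lemma Weierstrass_has_sum_integral:
  fixes c :: "'i \<Rightarrow> real \<Rightarrow> complex"
  assumes cont: "\<And>k. continuous_on {a..b} (c k)"
    and le: "\<And>k t. t \<in> {a..b} \<Longrightarrow> cmod (c k t) \<le> A k"
    and A: "A summable_on UNIV"
  shows "continuous_on {a..b} (\<lambda>t. \<Sum>\<^sub>\<infinity>k. c k t)"
    and "((\<lambda>k. integral {a..b} (c k)) has_sum integral {a..b} (\<lambda>t. \<Sum>\<^sub>\<infinity>k. c k t)) UNIV"
proof -
  have lim: "uniform_limit {a..b} (\<lambda>X t. \<Sum>k\<in>X. c k t) (\<lambda>t. \<Sum>\<^sub>\<infinity>k. c k t) (finite_subsets_at_top UNIV)"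
    by (rule Weierstrass_m_test_general[OF _ A]) (use le in auto)
  have cont_sum: "continuous_on {a..b} (\<lambda>t. \<Sum>k\<in>X. c k t)" for X
    by (intro continuous_intros cont)
  show "continuous_on {a..b} (\<lambda>t. \<Sum>\<^sub>\<infinity>k. c k t)"
    by (rule uniform_limit_theorem[OF _ lim]) (auto intro: cont_sum)
  obtain I J where I: "\<And>X. ((\<lambda>t. \<Sum>k\<in>X. c k t) has_integral I X) {a..b}"
    and J: "((\<lambda>t. \<Sum>\<^sub>\<infinity>k. c k t) has_integral J) {a..b}"
    and IJ: "(I \<longlongrightarrow> J) (finite_subsets_at_top UNIV)"
    using uniform_limit_integral[OF lim cont_sum] by auto
  have "I X = (\<Sum>k\<in>X. integral {a..b} (c k))" if "finite X" for X
    using I[of X] integral_sum[OF that, of c "{a..b}"] cont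
    by (simp add: integral_unique integrable_continuous_real)
  then have "((\<lambda>X. \<Sum>k\<in>X. integral {a..b} (c k)) \<longlongrightarrow> J) (finite_subsets_at_top UNIV)"
    by (intro Lim_transform_eventually[OF IJ] eventually_finite_subsets_at_top_weakI) auto
  then show "((\<lambda>k. integral {a..b} (c k)) has_sum integral {a..b} (\<lambda>t. \<Sum>\<^sub>\<infinity>k. c k t)) UNIV"
    using J by (simp add: has_sum_def integral_unique)
qed

text \<open>The step function with value \<open>A k\<close> on the cell \<open>[k - 1/2, k + 1/2]\<close> dominates \<open>h\<close> and has integral
  \<open>\<Sum>k. A k\<close>.\<close>

lemma integrable_if_summable_majorant:
  fixes h :: "real \<Rightarrow> complex"
  assumes [measurable]: "h \<in> borel_measurable lborel"
    and le: "\<And>k t. t \<in> {-1/2..1/2} \<Longrightarrow> cmod (h (t + of_int k)) \<le> A k"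
    and A: "A summable_on UNIV"
  shows "integrable lborel h"
proof (rule integrableI_bounded)
  have A0: "A k \<ge> 0" for k :: int
    using order_trans[OF norm_ge_zero le[of 0 k]] by simp
  define f where "f N x = (\<Sum>k\<in>{-int N..int N}. ennreal (A k) * indicator {of_int k - 1/2..of_int k + 1/2} x)"
    for N and x :: real
  have [measurable]: "f N \<in> borel_measurable lborel" for N
    unfolding f_def by measurable
  have incseq: "incseq f"
    unfolding f_def by (intro monoI le_funI sum_mono2) auto
  have "ennreal (cmod (h x)) \<le> (SUP N. f N x)" for x
  proof -
    define k where "k = \<lfloor>x + 1/2\<rfloor>"
    have x: "x \<in> {of_int k - 1/2..of_int k + 1/2}"
      unfolding k_def by (simp, linarith)
    have "cmod (h x) \<le> A k"
      using le[of "x - of_int k" k] x by (auto simp: algebra_simps)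
    then have "ennreal (cmod (h x)) \<le> ennreal (A k) * indicator {of_int k - 1/2..of_int k + 1/2} x"
      using x by (simp add: ennreal_leI)
    also have "\<dots> \<le> f (nat \<bar>k\<bar>) x"
      unfolding f_def by (rule member_le_sum) auto
    also have "\<dots> \<le> (SUP N. f N x)"
      by (rule SUP_upper) simp
    finally show ?thesis .
  qed
  then have "(\<integral>\<^sup>+x. ennreal (cmod (h x)) \<partial>lborel) \<le> (\<integral>\<^sup>+x. (SUP N. f N x) \<partial>lborel)"
    by (intro nn_integral_mono)
  also have "\<dots> = (SUP N. \<integral>\<^sup>+x. f N x \<partial>lborel)"
    by (rule nn_integral_monotone_convergence_SUP[OF incseq]) measurable
  also have "\<dots> \<le> ennreal (infsum A UNIV)"
  proof (rule SUP_least)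
    fix N
    have "(\<integral>\<^sup>+x. f N x \<partial>lborel) = (\<Sum>k\<in>{-int N..int N}.
        \<integral>\<^sup>+x. ennreal (A k) * indicator {of_int k - 1/2..of_int k + 1/2::real} x \<partial>lborel)"
      unfolding f_def by (rule nn_integral_sum) measurable
    also have "\<dots> = (\<Sum>k\<in>{-int N..int N}. ennreal (A k))"
      by (intro sum.cong refl) (simp add: nn_integral_cmult_indicator)
    also have "\<dots> = ennreal (\<Sum>k\<in>{-int N..int N}. A k)"
      by (simp add: A0)
    also have "\<dots> \<le> ennreal (infsum A UNIV)"
      by (intro ennreal_leI finite_sum_le_infsum A) (auto simp: A0)
    finally show "(\<integral>\<^sup>+x. f N x \<partial>lborel) \<le> ennreal (infsum A UNIV)" .
  qed
  finally show "(\<integral>\<^sup>+x. ennreal (norm (h x)) \<partial>lborel) < \<infinity>"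
    by (rule order_le_less_trans) simp
qed auto

text \<open>Unfolding: the translates of the unit cell by integers tile the line. The sum over \<open>k\<close> is
  evaluated along the exhaustion \<open>{-N..N}\<close>, for which the partial sums are integrals over growing
  intervals.\<close>

lemma integral_periodization:
  fixes h :: "real \<Rightarrow> complex"
  assumes cont: "continuous_on UNIV h"
    and le: "\<And>k t. t \<in> {-1/2..1/2} \<Longrightarrow> cmod (h (t + of_int k)) \<le> A k"
    and A: "A summable_on UNIV"
  shows "integral {-1/2..1/2} (\<lambda>t. \<Sum>\<^sub>\<infinity>k::int. h (t + of_int k)) = (LINT x|lborel. h x)"
proof -
  define I where "I k = integral {-1/2..1/2} (\<lambda>t. h (t + of_int k))" for k :: int
  define S where "S N = {-real N - 1/2..real N + 1/2}" for N
  have [measurable]: "h \<in> borel_measurable borel"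
    using cont by (rule borel_measurable_continuous_onI)
  have int: "integrable lborel h"
    by (rule integrable_if_summable_majorant[OF _ le A]) auto
  have cont_ab: "continuous_on {a..b} h" for a b
    using cont continuous_on_subset by blast
  have shift: "I k = integral {of_int k - 1/2..of_int k + 1/2} h" for k
    using integral_shift_Icc_real[of "-1/2" "1/2" h "of_int k"] by (simp add: I_def o_def add.commute)
  have sum_I: "(\<Sum>k\<in>{-int N..int N}. I k) = integral (S N) h" for N
  proof (induction N)
    case 0
    show ?case by (simp add: shift S_def)
  next
    case (Suc N)
    have "{-int (Suc N)..int (Suc N)} = insert (- int (Suc N)) (insert (int (Suc N)) {-int N..int N})"
      by auto
    then have "(\<Sum>k\<in>{-int (Suc N)..int (Suc N)}. I k) = I (- int (Suc N)) + (integral (S N) h + I (int (Suc N)))"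
      using Suc by simp
    also have "integral (S N) h + I (int (Suc N)) = integral {-real N - 1/2..real (Suc N) + 1/2} h"
    proof -
      have "I (int (Suc N)) = integral {real N + 1/2..real (Suc N) + 1/2} h"
        unfolding shift by (rule arg_cong[where f="\<lambda>X. integral X h"]) simp
      then show ?thesis
        unfolding S_def
        by (simp only:) (intro Henstock_Kurzweil_Integration.integral_combine integrable_continuous_real cont_ab; simp)
    qed
    also have "I (- int (Suc N)) + \<dots> = integral (S (Suc N)) h"
    proof -
      have "I (- int (Suc N)) = integral {-real (Suc N) - 1/2..-real N - 1/2} h"
        unfolding shift by (rule arg_cong[where f="\<lambda>X. integral X h"]) simp
      then show ?thesis
        unfolding S_def
        by (simp only:) (intro Henstock_Kurzweil_Integration.integral_combine integrable_continuous_real cont_ab; simp)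
    qed
    finally show ?case .
  qed
  have "(\<lambda>N. LINT x|lborel. indicator (S N) x *\<^sub>R h x) \<longlonglongrightarrow> (LINT x|lborel. h x)"
  proof (rule integral_dominated_convergence[where w="\<lambda>x. norm (h x)"])
    show "AE x in lborel. (\<lambda>N. indicator (S N) x *\<^sub>R h x) \<longlonglongrightarrow> h x"
    proof (rule AE_I2, rule tendsto_eventually)
      fix x
      obtain n where "\<bar>x\<bar> \<le> real n" using real_arch_simple by blast
      then show "\<forall>\<^sub>F N in sequentially. indicator (S N) x *\<^sub>R h x = h x"
        by (intro eventually_sequentiallyI[of n]) (auto simp: S_def indicator_def)
    qed
    show "AE x in lborel. norm (indicator (S N) x *\<^sub>R h x) \<le> norm (h x)" for N
      by (auto simp: indicator_def)
  qed (use int in \<open>auto simp: S_def\<close>)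
  moreover have "(LINT x|lborel. indicator (S N) x *\<^sub>R h x) = (\<Sum>k\<in>{-int N..int N}. I k)" for N
    using set_borel_integral_eq_integral(2)[OF borel_integrable_atLeastAtMost'[OF cont_ab]]
    by (simp add: sum_I S_def set_lebesgue_integral_def)
  ultimately have lim1: "(\<lambda>N. \<Sum>k\<in>{-int N..int N}. I k) \<longlonglongrightarrow> (LINT x|lborel. h x)" by simp
  have "(I has_sum integral {-1/2..1/2} (\<lambda>t. \<Sum>\<^sub>\<infinity>k::int. h (t + of_int k))) UNIV"
    unfolding I_def
    by (rule Weierstrass_has_sum_integral(2)[OF _ le A])
       (auto intro!: continuous_on_compose2[OF cont] continuous_intros)
  then have "((\<lambda>X. sum I X) \<longlongrightarrow> integral {-1/2..1/2} (\<lambda>t. \<Sum>\<^sub>\<infinity>k::int. h (t + of_int k)))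
      (finite_subsets_at_top UNIV)"
    by (simp add: has_sum_def)
  moreover have "filterlim (\<lambda>N. {-int N..int N}) (finite_subsets_at_top UNIV) sequentially"
    unfolding filterlim_finite_subsets_at_top
  proof (intro allI impI)
    fix X :: "int set" assume "finite X \<and> X \<subseteq> UNIV"
    then obtain b where b: "\<And>x. x \<in> X \<Longrightarrow> \<bar>x\<bar> \<le> b"
      by (metis finite_imageI Max_ge imageI)
    have "X \<subseteq> {-int N..int N}" if "N \<ge> nat b" for N
      using b that by (fastforce simp: abs_le_iff)
    then show "\<forall>\<^sub>F N in sequentially. finite {-int N..int N} \<and> X \<subseteq> {-int N..int N} \<and> {-int N..int N} \<subseteq> UNIV"
      by (auto intro!: eventually_sequentiallyI)
  qed
  ultimately have "(\<lambda>N. \<Sum>k\<in>{-int N..int N}. I k) \<longlonglongrightarrow> integral {-1/2..1/2} (\<lambda>t. \<Sum>\<^sub>\<infinity>k::int. h (t + of_int k))"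
    by (rule filterlim_compose)
  from LIMSEQ_unique[OF this lim1] show ?thesis .
qed

lemma fourier_eq_cis: "fourier f \<gamma> = (LINT x|lborel. f x * cis (- 2 * pi * \<gamma> * x))"
  by (simp add: fourier_def cis_conv_exp mult_ac)

text \<open>The difference of the periodization of \<open>h\<close> and the Fourier series with coefficients \<open>fourier h m\<close> is
  continuous, and all its Fourier coefficients are \<open>0\<close>; evaluate it at \<open>0\<close>.\<close>

lemma Poisson_summation:
  fixes h :: "real \<Rightarrow> complex"
  assumes cont: "continuous_on UNIV h"
    and le: "\<And>k t. t \<in> {-1/2..1/2} \<Longrightarrow> cmod (h (t + of_int k)) \<le> A k"
    and A: "A summable_on UNIV"
    and hat: "(\<lambda>m::int. cmod (fourier h (of_int m))) summable_on UNIV"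
  shows "(\<Sum>\<^sub>\<infinity>k::int. h (of_int k)) = (\<Sum>\<^sub>\<infinity>m::int. fourier h (of_int m))"
proof -
  let ?I = "{-1/2..1/2::real}"
  define \<phi> where "\<phi> t = (\<Sum>\<^sub>\<infinity>k::int. h (t + of_int k))" for t
  define \<sigma> where "\<sigma> t = (\<Sum>\<^sub>\<infinity>m::int. fourier h (of_int m) * cis (2 * pi * of_int m * t))" for t
  have cont_\<phi>: "continuous_on ?I \<phi>"
    unfolding \<phi>_def
    by (rule Weierstrass_has_sum_integral(1)[OF _ le A])
       (auto intro!: continuous_on_compose2[OF cont] continuous_intros)
  have cont_\<sigma>: "continuous_on ?I \<sigma>"
    unfolding \<sigma>_def
    by (rule Weierstrass_has_sum_integral(1)[OF _ _ hat])
       (auto intro!: continuous_intros simp: norm_mult)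
  have coeff_\<phi>: "integral ?I (\<lambda>t. \<phi> t * cis (2 * pi * of_int n * t)) = fourier h (- of_int n)" for n :: int
  proof -
    \<comment> \<open>the character is \<open>1\<close>-periodic, so it may be moved inside the periodization\<close>
    have per: "cis (2 * pi * of_int n * (t + of_int k)) = cis (2 * pi * of_int n * t)" for t and k :: int
      using cis_multiple_2pi[of "of_int (n * k)"] by (simp add: distrib_left mult.assoc flip: cis_mult)
    have "integral ?I (\<lambda>t. \<Sum>\<^sub>\<infinity>k::int. h (t + of_int k) * cis (2 * pi * of_int n * (t + of_int k)))
        = (LINT x|lborel. h x * cis (2 * pi * of_int n * x))"
      by (rule integral_periodization[OF _ _ A])
         (use le in \<open>auto intro!: continuous_intros cont simp: norm_mult\<close>)
    then show ?thesis
      by (simp add: per \<phi>_def fourier_eq_cis infsum_cmult_left')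
  qed
  have coeff_\<sigma>: "integral ?I (\<lambda>t. \<sigma> t * cis (2 * pi * of_int n * t)) = fourier h (- of_int n)" for n :: int
  proof -
    have "((\<lambda>m. integral ?I (\<lambda>t. fourier h (of_int m) * cis (2 * pi * of_int m * t) * cis (2 * pi * of_int n * t)))
        has_sum integral ?I (\<lambda>t. \<Sum>\<^sub>\<infinity>m::int. fourier h (of_int m) * cis (2 * pi * of_int m * t) * cis (2 * pi * of_int n * t))) UNIV"
      by (rule Weierstrass_has_sum_integral(2)[OF _ _ hat])
         (auto intro!: continuous_intros simp: norm_mult)
    moreover have "integral ?I (\<lambda>t. fourier h (of_int m) * cis (2 * pi * of_int m * t) * cis (2 * pi * of_int n * t))
       = (if m = -n then fourier h (- of_int n) else 0)" for m :: int
    proof -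
      have "((\<lambda>t. fourier h (of_int m) * cis (2 * pi * of_int (m + n) * t)) has_integral
           fourier h (of_int m) * (if m + n = 0 then 1 else 0)) ?I"
        by (intro has_integral_mult_right integral_cis)
      moreover have "fourier h (of_int m) * cis (2 * pi * of_int (m + n) * t)
          = fourier h (of_int m) * cis (2 * pi * of_int m * t) * cis (2 * pi * of_int n * t)" for t
        by (simp add: mult.assoc cis_mult distrib_left distrib_right)
      ultimately have "integral ?I (\<lambda>t. fourier h (of_int m) * cis (2 * pi * of_int m * t) * cis (2 * pi * of_int n * t))
          = fourier h (of_int m) * (if m + n = 0 then 1 else 0)"
        by (simp add: integral_unique del: of_int_add)
      then show ?thesis by (auto simp: add_eq_0_iff2)
    qed
    ultimately have "((\<lambda>m. if m = -n then fourier h (- of_int n) else 0) has_sum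
        integral ?I (\<lambda>t. \<sigma> t * cis (2 * pi * of_int n * t))) UNIV"
      by (simp add: \<sigma>_def infsum_cmult_left')
    moreover have "((\<lambda>m. if m = -n then fourier h (- of_int n) else 0) has_sum fourier h (- of_int n)) UNIV"
      by (rule has_sum_finite_neutralI[of "{-n}"]) auto
    ultimately show ?thesis by (rule infsumI[symmetric, THEN trans[OF _ infsumI]])
  qed
  have int: "(\<lambda>t. u t * cis (2 * pi * of_int n * t)) integrable_on ?I" if "continuous_on ?I u" for u and n :: int
    by (intro integrable_continuous_real continuous_intros that)
  have "(\<lambda>t. \<phi> t - \<sigma> t) 0 = 0"
  proof (rule zero_if_Fourier_coefficients_zero)
    show "continuous_on ?I (\<lambda>t. \<phi> t - \<sigma> t)"
      by (intro continuous_intros cont_\<phi> cont_\<sigma>)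
    show "integral ?I (\<lambda>t. (\<phi> t - \<sigma> t) * cis (2 * pi * of_int m * t)) = 0" for m :: int
      unfolding left_diff_distrib integral_diff[OF int[OF cont_\<phi>] int[OF cont_\<sigma>]] coeff_\<phi> coeff_\<sigma> by simp
  qed
  then show ?thesis by (simp add: \<phi>_def \<sigma>_def)
qed

section \<open>Dilations of functions in the Wiener space\<close>

text \<open>For continuous \<open>g\<close> the existence of such an \<open>A\<close> expresses that the Wiener norm of \<open>g\<close> is finite.
  Keeping the bounds on the cells as an explicit sequence allows them to be reindexed when \<open>g\<close>
  is dilated.\<close>

definition wiener_majorant :: "(int \<Rightarrow> real) \<Rightarrow> (real \<Rightarrow> complex) \<Rightarrow> bool" where
  "wiener_majorant A g \<longleftrightarrow> A summable_on UNIV \<and> (\<forall>k. \<forall>t\<in>{0..1}. cmod (g (t + of_int k)) \<le> A k)"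

text \<open>If \<open>N T \<ge> 1\<close>, the map \<open>k \<mapsto> \<lfloor>T k + b\<rfloor> + i\<close> is injective on each residue class modulo \<open>N\<close>, so the
  series splits into \<open>N\<close> subseries of a rearranged summable series.\<close>

lemma summable_on_floor_affine:
  fixes A :: "int \<Rightarrow> real" and T :: real
  assumes A: "A summable_on UNIV" and T: "T > 0"
  shows "(\<lambda>k::int. A (\<lfloor>T * of_int k + b\<rfloor> + i)) summable_on UNIV"
proof -
  define N where "N = max 1 \<lceil>1 / T\<rceil>"
  have N: "N > 0" by (simp add: N_def)
  have "1 / T \<le> of_int \<lceil>1 / T\<rceil>" by simp
  also have "\<dots> \<le> of_int N" unfolding of_int_le_iff by (simp add: N_def)
  finally have "1 / T \<le> of_int N" .
  then have NT: "T * of_int N \<ge> 1" using T by (simp add: field_simps)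
  define R where "R r = {k. k mod N = r}" for r
  let ?f = "\<lambda>k. \<lfloor>T * of_int k + b\<rfloor> + i"
  have less: "?f k < ?f k'" if "k \<in> R r" "k' \<in> R r" "k < k'" for r k k'
  proof -
    have "N dvd k' - k" using that mod_eq_dvd_iff[of k' N k] by (simp add: R_def)
    then have "N \<le> k' - k" using that by (intro zdvd_imp_le) auto
    then have "real_of_int N \<le> of_int k' - of_int k" by linarith
    then have "T * real_of_int N \<le> T * (real_of_int k' - real_of_int k)" using T by (intro mult_left_mono) auto
    then have "T * of_int k + b + 1 \<le> T * of_int k' + b" using NT by (simp add: algebra_simps)
    then show ?thesis by linarith
  qed
  have inj: "inj_on ?f (R r)" for r
  proof (rule inj_onI)
    fix k k' assume "k \<in> R r" "k' \<in> R r" "?f k = ?f k'"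
    then show "k = k'" using less[of k r k'] less[of k' r k] by (cases k k' rule: linorder_cases) auto
  qed
  have "(A \<circ> ?f) summable_on R r" for r
    using summable_on_reindex[OF inj] summable_on_subset_banach[OF A] by blast
  then have "((A \<circ> ?f) has_sum (\<Sum>r\<in>{0..<N}. infsum (A \<circ> ?f) (R r))) (\<Union>r\<in>{0..<N}. R r)"
    by (intro sum_has_sum has_sum_infsum) (auto simp: R_def)
  moreover have "(\<Union>r\<in>{0..<N}. R r) = UNIV"
    using N by (auto simp: R_def)
  ultimately show ?thesis by (auto simp: summable_on_def o_def)
qed

lemma summable_on_sum_finite:
  fixes f :: "'i \<Rightarrow> 'a \<Rightarrow> real"
  assumes "finite I" "\<And>i. i \<in> I \<Longrightarrow> f i summable_on X"
  shows "(\<lambda>x. \<Sum>i\<in>I. f i x) summable_on X"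
  using assms by (induction I rule: finite_induct) (auto intro: summable_on_add)

text \<open>The Wiener space is invariant under affine substitutions: \<open>T (x + [k - 1/2, k + 1/2])\<close> has
  length \<open>T\<close> and so meets only the cells with index between \<open>\<lfloor>T (x + k - 1/2)\<rfloor>\<close> and
  \<open>\<lfloor>T (x + k - 1/2)\<rfloor> + \<lceil>T\<rceil>\<close>.\<close>

lemma wiener_majorant_dilation:
  assumes g: "wiener_majorant A g" and T: "T > 0"
  shows "\<exists>B. B summable_on UNIV \<and>
    (\<forall>k. \<forall>t\<in>{-1/2..1/2}. cmod (g (T * (x + (t + of_int k)))) \<le> B k)"
proof (intro exI conjI allI ballI)
  define f where "f k = \<lfloor>T * of_int k + T * (x - 1/2)\<rfloor>" for k :: int
  define B where "B k = (\<Sum>i\<in>{0..\<lceil>T\<rceil>}. A (f k + i))" for k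
  show "B summable_on UNIV"
    unfolding B_def f_def using g T
    by (intro summable_on_sum_finite summable_on_floor_affine) (simp_all add: wiener_majorant_def)
  have A0: "A k \<ge> 0" for k
  proof -
    have "cmod (g (0 + of_int k)) \<le> A k"
      using g[unfolded wiener_majorant_def, THEN conjunct2, rule_format, of 0 k] by simp
    then show ?thesis by (rule order_trans[OF norm_ge_zero])
  qed
  show "cmod (g (T * (x + (t + of_int k)))) \<le> B k" if t: "t \<in> {-1/2..1/2}" for k t
  proof -
    define y where "y = T * (x + (t + of_int k))"
    define z where "z = T * of_int k + T * (x - 1/2)"
    have y: "y = z + T * (t + 1/2)" by (simp add: y_def z_def algebra_simps)
    have "0 \<le> T * (t + 1/2)" "T * (t + 1/2) \<le> T * 1"
      using t T by (auto intro!: mult_left_mono)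
    then have "z \<le> y" "y \<le> z + of_int \<lceil>T\<rceil>" unfolding y by linarith+
    then have i: "\<lfloor>y\<rfloor> - f k \<in> {0..\<lceil>T\<rceil>}" unfolding f_def z_def[symmetric] by (simp, linarith)
    have "cmod (g (frac y + of_int \<lfloor>y\<rfloor>)) \<le> A \<lfloor>y\<rfloor>"
      using g by (auto simp: wiener_majorant_def less_imp_le frac_lt_1)
    then have "cmod (g y) \<le> A (f k + (\<lfloor>y\<rfloor> - f k))" by (simp add: frac_def)
    also have "\<dots> \<le> B k"
      unfolding B_def by (rule member_le_sum[OF i]) (auto simp: A0)
    finally show ?thesis by (simp add: y_def)
  qed
qed

lemma summable_on_samples:
  assumes g: "wiener_majorant A g" and T: "T > 0"
  shows "(\<lambda>k::int. cmod (g (T * (x + of_int k)))) summable_on UNIV"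
proof -
  obtain B where B: "B summable_on UNIV"
    "\<And>k t. t \<in> {-1/2..1/2} \<Longrightarrow> cmod (g (T * (x + (t + of_int k)))) \<le> B k"
    using wiener_majorant_dilation[OF g T, of x] by blast
  show ?thesis
    by (rule summable_on_comparison_test[OF B(1)]) (use B(2)[of 0] in auto)
qed

lemma integrable_wiener:
  assumes cont: "continuous_on UNIV g" and g: "wiener_majorant A g"
  shows "integrable lborel g"
proof -
  obtain B where B: "B summable_on UNIV"
    "\<And>k t. t \<in> {-1/2..1/2} \<Longrightarrow> cmod (g (t + of_int k)) \<le> B k"
    using wiener_majorant_dilation[OF g zero_less_one, of 0] by auto
  then show ?thesis
    using borel_measurable_continuous_onI[OF cont] by (intro integrable_if_summable_majorant) auto
qed

section \<open>The Zak transform\<close>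

lemma zak_eq_cis:
  "zak a f x \<gamma> = of_real (sqrt a) * (\<Sum>\<^sub>\<infinity>k::int. f (a * (x + of_int k)) * cis (- 2 * pi * of_int k * \<gamma>))"
  by (simp add: zak_def cis_conv_exp mult_ac)

text \<open>Poisson summation for \<open>y \<mapsto> g (T (x + y)) e(-\<gamma> y)\<close>, whose Fourier coefficients are, up to
  phases, samples of the Fourier transform of \<open>g\<close> on a grid of width \<open>1 / T\<close>.\<close>

lemma zak_fourier:
  assumes cont: "continuous_on UNIV g" and g: "wiener_majorant A g"
    and g': "wiener_majorant A' (fourier g)" and T: "T > 0"
  shows "zak T g x \<gamma> = cis (2 * pi * x * \<gamma>) * zak (1 / T) (fourier g) \<gamma> (- x)"
proof -
  define h where "h y = g (T * (x + y)) * cis (- 2 * pi * \<gamma> * y)" for y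
  obtain B where B: "B summable_on UNIV"
    "\<And>k t. t \<in> {-1/2..1/2} \<Longrightarrow> cmod (g (T * (x + (t + of_int k)))) \<le> B k"
    using wiener_majorant_dilation[OF g T, of x] by blast
  have hat: "fourier h (of_int m) =
      of_real (1 / T) * cis (2 * pi * x * \<gamma>) * (fourier g (1 / T * (\<gamma> + of_int m)) * cis (- 2 * pi * of_int m * (-x)))" for m :: int
  proof -
    define \<xi> where "\<xi> = of_int m + \<gamma>"
    have "fourier g (\<xi> / T) * cis (2 * pi * \<xi> * x) = (LINT u|lborel. g u * cis (- 2 * pi * (\<xi> / T) * u) * cis (2 * pi * \<xi> * x))"
      unfolding fourier_eq_cis by simp
    also have "\<dots> = \<bar>T\<bar> *\<^sub>R (LINT y|lborel. g (T * x + T * y) * cis (- 2 * pi * (\<xi> / T) * (T * x + T * y)) * cis (2 * pi * \<xi> * x))"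
      using T by (intro lborel_integral_real_affine) simp
    also have "(\<lambda>y. g (T * x + T * y) * cis (- 2 * pi * (\<xi> / T) * (T * x + T * y)) * cis (2 * pi * \<xi> * x))
        = (\<lambda>y. h y * cis (- 2 * pi * of_int m * y))"
    proof
      fix y
      have "- 2 * pi * (\<xi> / T) * (T * x + T * y) + 2 * pi * \<xi> * x = - 2 * pi * \<gamma> * y + - 2 * pi * of_int m * y"
        using T by (simp add: \<xi>_def field_simps)
      then have "cis (- 2 * pi * (\<xi> / T) * (T * x + T * y)) * cis (2 * pi * \<xi> * x)
          = cis (- 2 * pi * \<gamma> * y) * cis (- 2 * pi * of_int m * y)"
        unfolding cis_mult by (rule arg_cong)
      then show "g (T * x + T * y) * cis (- 2 * pi * (\<xi> / T) * (T * x + T * y)) * cis (2 * pi * \<xi> * x)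
          = h y * cis (- 2 * pi * of_int m * y)"
        unfolding h_def distrib_left[of T x y] mult.assoc[of "g _"] by (rule arg_cong)
    qed
    finally have "fourier h (of_int m) = of_real (1 / T) * (fourier g (\<xi> / T) * cis (2 * pi * \<xi> * x))"
      using T by (simp add: fourier_eq_cis scaleR_conv_of_real)
    also have "cis (2 * pi * \<xi> * x) = cis (2 * pi * x * \<gamma>) * cis (- 2 * pi * of_int m * (-x))"
      by (simp add: cis_mult \<xi>_def algebra_simps)
    finally show ?thesis by (simp add: \<xi>_def mult_ac add.commute)
  qed
  have "(\<Sum>\<^sub>\<infinity>k::int. h (of_int k)) = (\<Sum>\<^sub>\<infinity>m::int. fourier h (of_int m))"
  proof (rule Poisson_summation[OF _ _ B(1)])
    show "continuous_on UNIV h"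
      unfolding h_def by (intro continuous_intros continuous_on_compose2[OF cont]) auto
    show "cmod (h (t + of_int k)) \<le> B k" if "t \<in> {-1/2..1/2}" for k t
      using B(2)[OF that] by (simp add: h_def norm_mult)
    show "(\<lambda>m::int. cmod (fourier h (of_int m))) summable_on UNIV"
      unfolding hat norm_mult norm_cis using T
      by (intro summable_on_cmult_right summable_on_cmult_left summable_on_samples[OF g']) simp
  qed
  also have "\<dots> = of_real (1 / T) * cis (2 * pi * x * \<gamma>) *
      (\<Sum>\<^sub>\<infinity>m::int. fourier g (1 / T * (\<gamma> + of_int m)) * cis (- 2 * pi * of_int m * (-x)))"
    unfolding hat by (rule infsum_cmult_right')
  finally have eq: "zak T g x \<gamma> = of_real (sqrt T * (1 / T)) * cis (2 * pi * x * \<gamma>) *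
      (\<Sum>\<^sub>\<infinity>m::int. fourier g (1 / T * (\<gamma> + of_int m)) * cis (- 2 * pi * of_int m * (-x)))"
    by (simp add: zak_eq_cis h_def mult_ac)
  have "sqrt T * (1 / T) = sqrt (1 / T)"
    using T by (simp add: real_sqrt_divide field_simps)
  from eq[unfolded this] show ?thesis
    unfolding zak_eq_cis[of "1 / T"] by (simp only: mult_ac)
qed

lemma zak_add_int_right: "zak a f x (\<gamma> + of_int j) = zak a f x \<gamma>"
proof -
  have "cis (- 2 * pi * of_int k * (\<gamma> + of_int j)) = cis (- 2 * pi * of_int k * \<gamma>) * cis (2 * pi * of_int (- k * j))" for k
    unfolding cis_mult by (simp add: algebra_simps)
  then have "cis (- 2 * pi * of_int k * (\<gamma> + of_int j)) = cis (- 2 * pi * of_int k * \<gamma>)" for k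
    by (simp only: cis_multiple_2pi[OF Ints_of_int] mult_1_right)
  then show ?thesis by (simp only: zak_eq_cis)
qed

lemma zak_add_one_left: "zak a f (x + 1) \<gamma> = cis (2 * pi * \<gamma>) * zak a f x \<gamma>"
proof -
  have "(\<Sum>\<^sub>\<infinity>k::int. f (a * (x + of_int k)) * cis (- 2 * pi * of_int k * \<gamma>)) =
        (\<Sum>\<^sub>\<infinity>k::int. f (a * (x + of_int (k + 1))) * cis (- 2 * pi * of_int (k + 1) * \<gamma>))"
    by (rule infsum_reindex_bij_witness[of _ "\<lambda>k. k + 1" "\<lambda>k. k - 1"]) auto
  also have "\<dots> = (\<Sum>\<^sub>\<infinity>k::int. cis (- 2 * pi * \<gamma>) * (f (a * (x + 1 + of_int k)) * cis (- 2 * pi * of_int k * \<gamma>)))"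
    by (intro infsum_cong) (simp add: cis_mult algebra_simps)
  also have "\<dots> = cis (- 2 * pi * \<gamma>) * (\<Sum>\<^sub>\<infinity>k::int. f (a * (x + 1 + of_int k)) * cis (- 2 * pi * of_int k * \<gamma>))"
    by (rule infsum_cmult_right')
  finally show ?thesis
    by (simp add: zak_eq_cis mult.left_commute[of "cis (2 * pi * \<gamma>)"] cis_mult flip: mult.assoc)
qed

text \<open>Write the summation index as \<open>n k + q\<close> with \<open>0 \<le> q < n\<close>; each residue \<open>q\<close> contributes a Zak series
  on the coarser grid of width \<open>n a\<close>.\<close>

lemma zak_decimation:
  assumes g: "wiener_majorant A g" and a: "a > 0" and n: "n > 0"
  shows "zak a g x \<gamma> = of_real (1 / sqrt (real n)) *
    (\<Sum>q<n. cis (- 2 * pi * real q * \<gamma>) * zak (real n * a) g ((x + real q) / real n) (real n * \<gamma>))"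
proof -
  define F where "F m = g (a * (x + of_int m)) * cis (- 2 * pi * of_int m * \<gamma>)" for m :: int
  define R where "R q = range (\<lambda>k::int. int n * k + int q)" for q
  have F: "F summable_on UNIV"
    by (rule abs_summable_summable)
       (use summable_on_samples[OF g a] in \<open>simp add: F_def norm_mult\<close>)
  have inj: "inj (\<lambda>k::int. int n * k + int q)" for q
    using n by (auto simp: inj_def)
  have R: "m \<in> R q \<longleftrightarrow> m mod int n = int q" if "q < n" for m q
  proof
    assume "m mod int n = int q"
    then have "m = int n * (m div int n) + int q" by (metis mult_div_mod_eq)
    then show "m \<in> R q" by (auto simp: R_def)
  qed (use that in \<open>auto simp: R_def\<close>)
  have "(F has_sum (\<Sum>q<n. infsum F (R q))) (\<Union>q\<in>{..<n}. R q)"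
    by (intro sum_has_sum has_sum_infsum summable_on_subset_banach[OF F]) (auto simp: R)
  moreover have "(\<Union>q\<in>{..<n}. R q) = UNIV"
  proof -
    have "m \<in> R (nat (m mod int n))" "nat (m mod int n) < n" for m
      using n by (auto simp: R nat_less_iff)
    then show ?thesis by blast
  qed
  ultimately have "infsum F UNIV = (\<Sum>q<n. infsum F (R q))"
    by (metis infsumI)
  also have "\<dots> = (\<Sum>q<n. cis (- 2 * pi * real q * \<gamma>) *
     (\<Sum>\<^sub>\<infinity>k::int. g (real n * a * ((x + real q) / real n + of_int k)) * cis (- 2 * pi * of_int k * (real n * \<gamma>))))"
  proof (rule sum.cong[OF refl])
    fix q
    have "infsum F (R q) = (\<Sum>\<^sub>\<infinity>k::int. F (int n * k + int q))"
      unfolding R_def using infsum_reindex[OF inj] by (simp add: o_def)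
    also have "\<dots> = (\<Sum>\<^sub>\<infinity>k::int. cis (- 2 * pi * real q * \<gamma>) *
       (g (real n * a * ((x + real q) / real n + of_int k)) * cis (- 2 * pi * of_int k * (real n * \<gamma>))))"
    proof (rule infsum_cong)
      fix k :: int
      have "a * (x + of_int (int n * k + int q)) = real n * a * ((x + real q) / real n + of_int k)"
        using n by (simp add: field_simps)
      moreover have "cis (- 2 * pi * of_int (int n * k + int q) * \<gamma>)
          = cis (- 2 * pi * real q * \<gamma>) * cis (- 2 * pi * of_int k * (real n * \<gamma>))"
        unfolding cis_mult by (simp add: algebra_simps)
      ultimately show "F (int n * k + int q) = cis (- 2 * pi * real q * \<gamma>) *
          (g (real n * a * ((x + real q) / real n + of_int k)) * cis (- 2 * pi * of_int k * (real n * \<gamma>)))"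
        unfolding F_def by (simp only: mult.left_commute)
    qed
    also have "\<dots> = cis (- 2 * pi * real q * \<gamma>) *
       (\<Sum>\<^sub>\<infinity>k::int. g (real n * a * ((x + real q) / real n + of_int k)) * cis (- 2 * pi * of_int k * (real n * \<gamma>)))"
      by (rule infsum_cmult_right')
    finally show "infsum F (R q) = \<dots>" .
  qed
  finally have F_sum: "infsum F UNIV = \<dots>" .
  have "1 / sqrt (real n) * sqrt (real n * a) = sqrt a"
    using n by (simp add: real_sqrt_mult)
  then have eq: "complex_of_real (sqrt a) = of_real (1 / sqrt (real n)) * of_real (sqrt (real n * a))"
    by (simp only: flip: of_real_mult)
  have "zak a g x \<gamma> = of_real (sqrt a) * infsum F UNIV"
    by (simp add: zak_eq_cis F_def[abs_def])
  then show ?thesis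
    unfolding F_sum zak_eq_cis[of "real n * a"]
    by (simp only: eq sum_distrib_left mult_ac)
qed

section \<open>The Fourier transform on the intersection of L1 and L2\<close>

lemma measurable_cis [measurable]: "cis \<in> borel_measurable borel"
  by (intro borel_measurable_continuous_onI continuous_intros)

lemma integrable_mult_bounded:
  fixes f g :: "real \<Rightarrow> complex"
  assumes f: "integrable lborel f" and [measurable]: "g \<in> borel_measurable lborel"
    and C: "\<And>x. cmod (g x) \<le> C"
  shows "integrable lborel (\<lambda>x. f x * g x)"
proof (rule Bochner_Integration.integrable_bound)
  show "integrable lborel (\<lambda>x. norm (f x) * C)" using f by simp
  have [measurable]: "f \<in> borel_measurable lborel" using f by simp
  show "(\<lambda>x. f x * g x) \<in> borel_measurable lborel" by measurable
  have "cmod (f x * g x) \<le> cmod (f x) * \<bar>C\<bar>" for x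
    unfolding norm_mult using C[of x] by (intro mult_left_mono) auto
  then show "AE x in lborel. norm (f x * g x) \<le> norm (norm (f x) * C)"
    by (auto simp: abs_mult)
qed

lemma integrable_mult_cis:
  assumes "integrable lborel f"
  shows "integrable lborel (\<lambda>x. f x * cis (c * x))"
  by (rule integrable_mult_bounded[OF assms, where C=1]) auto

lemma norm_fourier_le:
  assumes "integrable lborel f"
  shows "cmod (fourier f \<gamma>) \<le> (LINT x|lborel. cmod (f x))"
  unfolding fourier_eq_cis
  by (rule order_trans[OF integral_norm_bound]) (simp add: norm_mult)

lemma continuous_fourier:
  assumes f: "integrable lborel f"
  shows "continuous_on UNIV (fourier f)"
  unfolding continuous_on_eq_continuous_at[OF open_UNIV]
proof (intro ballI)
  fix \<gamma> :: real
  have [measurable]: "f \<in> borel_measurable lborel" using f by simp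
  show "isCont (fourier f) \<gamma>"
  proof (rule continuous_at_sequentiallyI)
    fix u :: "nat \<Rightarrow> real" assume u: "u \<longlonglongrightarrow> \<gamma>"
    show "(\<lambda>n. fourier f (u n)) \<longlonglongrightarrow> fourier f \<gamma>"
      unfolding fourier_eq_cis
    proof (rule integral_dominated_convergence[where w="\<lambda>x. cmod (f x)"])
      show "AE x in lborel. (\<lambda>n. f x * cis (- 2 * pi * u n * x)) \<longlonglongrightarrow> f x * cis (- 2 * pi * \<gamma> * x)"
        by (intro AE_I2 tendsto_intros u)
    qed (use f in \<open>auto simp: norm_mult\<close>)
  qed
qed

lemma measurable_fourier [measurable_dest]:
  "integrable lborel f \<Longrightarrow> fourier f \<in> borel_measurable borel"
  by (intro borel_measurable_continuous_onI continuous_fourier)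

text \<open>Fubini's theorem for \<open>f x \<phi> \<gamma> e(-x \<gamma>)\<close>.\<close>

lemma fourier_multiplication_formula:
  assumes f: "integrable lborel f" and \<phi>: "integrable lborel \<phi>"
  shows "(LINT \<gamma>|lborel. fourier f \<gamma> * \<phi> \<gamma>) = (LINT x|lborel. f x * fourier \<phi> x)"
proof -
  have [measurable]: "f \<in> borel_measurable lborel" "\<phi> \<in> borel_measurable lborel"
    using f \<phi> by auto
  define F where "F x \<gamma> = f x * (\<phi> \<gamma> * cis (- 2 * pi * x * \<gamma>))" for x \<gamma>
  have "integrable (lborel \<Otimes>\<^sub>M lborel) (\<lambda>(x, \<gamma>). F x \<gamma>)"
  proof (rule lborel_pair.Fubini_integrable)
    show "integrable lborel (\<lambda>x. LINT \<gamma>|lborel. norm (case (x, \<gamma>) of (x, \<gamma>) \<Rightarrow> F x \<gamma>))"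
      using f by (simp add: F_def norm_mult)
    show "AE x in lborel. integrable lborel (\<lambda>\<gamma>. case (x, \<gamma>) of (x, \<gamma>) \<Rightarrow> F x \<gamma>)"
      unfolding F_def prod.case by (intro AE_I2 integrable_mult_right integrable_mult_cis \<phi>)
  qed (simp add: F_def)
  then have "(LINT \<gamma>|lborel. LINT x|lborel. F x \<gamma>) = (LINT x|lborel. LINT \<gamma>|lborel. F x \<gamma>)"
    by (rule lborel_pair.Fubini_integral)
  moreover have "(LINT x|lborel. F x \<gamma>) = fourier f \<gamma> * \<phi> \<gamma>" for \<gamma>
  proof -
    have "(\<lambda>x. F x \<gamma>) = (\<lambda>x. f x * cis (- 2 * pi * \<gamma> * x) * \<phi> \<gamma>)"
      by (simp add: F_def fun_eq_iff mult_ac)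
    then show ?thesis by (simp add: fourier_eq_cis)
  qed
  moreover have "(LINT \<gamma>|lborel. F x \<gamma>) = f x * fourier \<phi> x" for x
    by (simp add: F_def fourier_eq_cis)
  ultimately show ?thesis by simp
qed

text \<open>Cauchy-Schwarz: integration against a square integrable function is continuous in \<open>L\<^sup>2\<close>.\<close>

lemma L2_tendsto_integral_mult:
  assumes conv: "L2_tendsto u f" and K2: "(\<integral>\<^sup>+x. ennreal ((cmod (K x))\<^sup>2) \<partial>lborel) < \<infinity>"
    and [measurable]: "\<And>n. u n \<in> borel_measurable lborel" "f \<in> borel_measurable lborel" "K \<in> borel_measurable lborel"
    and int: "\<And>n. integrable lborel (\<lambda>x. u n x * K x)" "integrable lborel (\<lambda>x. f x * K x)"
  shows "(\<lambda>n. LINT x|lborel. u n x * K x) \<longlonglongrightarrow> (LINT x|lborel. f x * K x)"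
proof -
  define E where "E n = (\<integral>\<^sup>+x. ennreal ((cmod (u n x - f x))\<^sup>2) \<partial>lborel)" for n
  define G where "G = (\<integral>\<^sup>+x. ennreal ((cmod (K x))\<^sup>2) \<partial>lborel)"
  let ?d = "\<lambda>n. (LINT x|lborel. u n x * K x) - (LINT x|lborel. f x * K x)"
  have le: "ennreal ((cmod (?d n))\<^sup>2) \<le> E n * G" for n
  proof -
    have "?d n = (LINT x|lborel. (u n x - f x) * K x)"
      using int by (simp add: left_diff_distrib)
    then have "ennreal (cmod (?d n)) \<le> (\<integral>\<^sup>+x. ennreal (cmod ((u n x - f x) * K x)) \<partial>lborel)"
      using int by (simp only:) (intro integral_norm_bound_ennreal, simp add: left_diff_distrib)
    also have "\<dots> = (\<integral>\<^sup>+x. ennreal (cmod (u n x - f x)) * ennreal (cmod (K x)) \<partial>lborel)"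
      by (simp add: norm_mult ennreal_mult)
    finally have "(ennreal (cmod (?d n)))\<^sup>2 \<le> (\<integral>\<^sup>+x. ennreal (cmod (u n x - f x)) * ennreal (cmod (K x)) \<partial>lborel)\<^sup>2"
      by (intro power_mono) auto
    also have "\<dots> \<le> (\<integral>\<^sup>+x. (ennreal (cmod (u n x - f x)))\<^sup>2 \<partial>lborel) * (\<integral>\<^sup>+x. (ennreal (cmod (K x)))\<^sup>2 \<partial>lborel)"
      by (rule Cauchy_Schwarz_nn_integral) measurable
    finally show ?thesis by (simp add: E_def G_def ennreal_power)
  qed
  have lim: "(\<lambda>n. E n * G) \<longlonglongrightarrow> 0 * G"
    using conv K2 unfolding L2_tendsto_def E_def[symmetric] G_def[symmetric]
    by (intro tendsto_mult_ennreal) (auto simp: tendsto_const)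
  have "(\<lambda>n. ennreal ((cmod (?d n))\<^sup>2)) \<longlonglongrightarrow> 0"
    by (rule tendsto_sandwich[OF _ _ tendsto_const lim[unfolded mult_zero_left]])
       (simp_all add: le always_eventually)
  then have "(\<lambda>n. (cmod (?d n))\<^sup>2) \<longlonglongrightarrow> 0"
    by (simp add: tendsto_ennreal_iff flip: ennreal_0)
  then have "(\<lambda>n. sqrt ((cmod (?d n))\<^sup>2)) \<longlonglongrightarrow> sqrt 0" by (rule tendsto_real_sqrt)
  then have "?d \<longlonglongrightarrow> 0" by (simp add: tendsto_norm_zero_iff)
  then show ?thesis by (rule LIM_zero_cancel)
qed

lemma integrable_indicator_Icc:
  "integrable lborel (indicator {a..b} :: real \<Rightarrow> complex)"
proof -
  have "(\<lambda>x. indicator {a..b} x *\<^sub>R 1) = (indicator {a..b} :: real \<Rightarrow> complex)"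
    by (auto simp: indicator_def)
  then show ?thesis
    using borel_integrable_atLeastAtMost'[of a b "\<lambda>_. 1 :: complex"] by (simp add: set_integrable_def)
qed

text \<open>The transform of an interval is bounded by the length of the interval and, being a sinc up to a
  phase, also by \<open>1 / \<bar>x\<bar>\<close>; so its square is at most a multiple of \<open>1 / (1 + x\<^sup>2)\<close>.\<close>

lemma fourier_interval_indicator_L2:
  assumes "a \<le> b"
  shows "(\<integral>\<^sup>+x. ennreal ((cmod (fourier (indicator {a..b}) x))\<^sup>2) \<partial>lborel) < \<infinity>"
proof -
  let ?K = "fourier (indicator {a..b})"
  have int: "integrable lborel (indicator {a..b} :: real \<Rightarrow> complex)"
    by (rule integrable_indicator_Icc)
  have "(LINT x|lborel. cmod (indicator {a..b} x)) = (LINT x|lborel. indicator {a..b} x)"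
    by (intro Bochner_Integration.integral_cong) (auto simp: indicator_def)
  then have 1: "cmod (?K x) \<le> b - a" for x
    using norm_fourier_le[OF int, of x] assms by simp
  have 2: "\<bar>x\<bar> * cmod (?K x) \<le> 1" for x
  proof (cases "x = 0")
    case False
    define c where "c = - 2 * pi * x"
    have c: "c \<noteq> 0" using False by (simp add: c_def)
    define P where "P t = cis (c * t) / (\<i> * of_real c)" for t
    have "(P has_vector_derivative cis (c * t)) (at t within {a..b})" for t
      unfolding P_def[abs_def] cis_conv_exp using c
      by (auto intro!: derivative_eq_intros has_vector_derivative_real_field simp: field_simps)
    then have "((\<lambda>t. cis (c * t)) has_integral (P b - P a)) {a..b}"
      using assms by (intro fundamental_theorem_of_calculus) auto
    moreover have "?K x = integral {a..b} (\<lambda>t. cis (c * t))"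
    proof -
      have "?K x = (LINT t:{a..b}|lborel. cis (c * t))"
        by (auto simp: fourier_eq_cis c_def set_lebesgue_integral_def indicator_def intro!: Bochner_Integration.integral_cong)
      also have "\<dots> = integral {a..b} (\<lambda>t. cis (c * t))"
        by (intro set_borel_integral_eq_integral borel_integrable_atLeastAtMost' continuous_intros)
      finally show ?thesis .
    qed
    ultimately have "cmod (?K x) = cmod (P b - P a)" by (simp add: integral_unique)
    also have "\<dots> \<le> 2 / \<bar>c\<bar>"
      using norm_triangle_ineq4[of "P b" "P a"] by (simp add: P_def norm_divide norm_mult)
    finally have "\<bar>x\<bar> * cmod (?K x) \<le> \<bar>x\<bar> * (2 / \<bar>c\<bar>)" by (intro mult_left_mono) auto
    also have "\<dots> = 1 / pi" using False by (simp add: c_def abs_mult)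
    also have "\<dots> \<le> 1" using pi_gt3 by simp
    finally show ?thesis .
  qed simp
  have le: "(cmod (?K x))\<^sup>2 \<le> ((b - a)\<^sup>2 + 1) * inverse (1 + x\<^sup>2)" for x
  proof -
    have "(cmod (?K x))\<^sup>2 \<le> (b - a)\<^sup>2" using 1 by (intro power_mono) auto
    moreover have "(\<bar>x\<bar> * cmod (?K x))\<^sup>2 \<le> 1" using 2[of x] by (intro power_le_one) auto
    ultimately have "(cmod (?K x))\<^sup>2 * (1 + x\<^sup>2) \<le> (b - a)\<^sup>2 + 1"
      by (simp add: power_mult_distrib algebra_simps)
    moreover have "1 + x\<^sup>2 > 0" by (simp add: add_pos_nonneg)
    ultimately show ?thesis by (simp add: field_simps)
  qed
  have "integrable lborel (\<lambda>x::real. ((b - a)\<^sup>2 + 1) * inverse (1 + x\<^sup>2))"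
    using integrable_inverse_1_plus_square by (simp add: set_integrable_def)
  then have "integrable lborel (\<lambda>x. (cmod (?K x))\<^sup>2)"
  proof (rule Bochner_Integration.integrable_bound)
    show "(\<lambda>x. (cmod (?K x))\<^sup>2) \<in> borel_measurable lborel"
      using measurable_fourier[OF int] by measurable
    show "AE x in lborel. norm ((cmod (?K x))\<^sup>2) \<le> norm (((b - a)\<^sup>2 + 1) * inverse (1 + x\<^sup>2))"
      unfolding real_norm_def abs_power2 by (intro AE_I2 order_trans[OF le abs_ge_self])
  qed
  then show ?thesis by (simp add: integrable_iff_bounded)
qed

text \<open>Let \<open>u n\<close> in \<open>L\<^sup>1 \<inter> L\<^sup>2\<close> tend to \<open>g\<close> and \<open>fourier (u n)\<close> to \<open>F\<close> in \<open>L\<^sup>2\<close>, and let \<open>\<phi>\<close> be the indicator of an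
  interval. Then \<open>\<integral> F \<phi> = lim \<integral> fourier (u n) \<phi> = lim \<integral> u n (fourier \<phi>) = \<integral> g (fourier \<phi>) = \<integral> fourier g \<phi>\<close>,
  since both \<open>\<phi>\<close> and its transform are square integrable. Two continuous functions with the same
  integral over every interval agree.\<close>

lemma fourier_eq_L2_fourier:
  assumes g: "integrable lborel g" and gF: "is_fourier_L2 g F" and F: "continuous_on UNIV F"
  shows "fourier g = F"
proof -
  obtain u where u: "\<And>n. integrable lborel (u n)" and ug: "L2_tendsto u g"
    and uF: "L2_tendsto (\<lambda>n. fourier (u n)) F"
    using gF by (auto simp: is_fourier_L2_def L1_def)
  have [measurable]: "\<And>n. u n \<in> borel_measurable lborel" "g \<in> borel_measurable lborel"
    "F \<in> borel_measurable borel" "\<And>n. fourier (u n) \<in> borel_measurable borel"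
    "fourier g \<in> borel_measurable borel"
    using u g F by (auto intro: borel_measurable_continuous_onI measurable_fourier)
  define D where "D x = F x - fourier g x" for x
  have contD: "continuous_on S D" for S
    unfolding D_def using continuous_on_subset[OF F] continuous_on_subset[OF continuous_fourier[OF g]]
    by (intro continuous_intros) auto
  have zero: "integral {a..b} D = 0" if ab: "a \<le> b" for a b
  proof -
    let ?\<phi> = "indicator {a..b} :: real \<Rightarrow> complex"
    have \<phi>: "integrable lborel ?\<phi>" by (rule integrable_indicator_Icc)
    have [measurable]: "fourier ?\<phi> \<in> borel_measurable borel" using \<phi> by (rule measurable_fourier)
    have cont_int: "integrable lborel (\<lambda>x. v x * ?\<phi> x)" if "continuous_on UNIV v" for v
    proof -
      have "integrable lborel (\<lambda>x. indicator {a..b} x *\<^sub>R v x)"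
        using borel_integrable_atLeastAtMost'[OF continuous_on_subset[OF that]]
        by (simp add: set_integrable_def)
      also have "(\<lambda>x. indicator {a..b} x *\<^sub>R v x) = (\<lambda>x. v x * ?\<phi> x)"
        by (auto simp: indicator_def)
      finally show ?thesis .
    qed
    have int_K: "integrable lborel (\<lambda>x. v x * fourier ?\<phi> x)" if "integrable lborel v" for v
      by (rule integrable_mult_bounded[OF that _ norm_fourier_le[OF \<phi>]]) measurable
    have "(\<lambda>n. LINT x|lborel. u n x * fourier ?\<phi> x) \<longlonglongrightarrow> (LINT x|lborel. g x * fourier ?\<phi> x)"
      using ug fourier_interval_indicator_L2[OF ab]
      by (rule L2_tendsto_integral_mult) (auto intro: int_K u g)
    then have "(\<lambda>n. LINT x|lborel. fourier (u n) x * ?\<phi> x) \<longlonglongrightarrow> (LINT x|lborel. fourier g x * ?\<phi> x)"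
      by (simp only: fourier_multiplication_formula[OF u \<phi>] fourier_multiplication_formula[OF g \<phi>])
    moreover have "(\<lambda>n. LINT x|lborel. fourier (u n) x * ?\<phi> x) \<longlonglongrightarrow> (LINT x|lborel. F x * ?\<phi> x)"
    proof (rule L2_tendsto_integral_mult[OF uF])
      have "(\<integral>\<^sup>+x. ennreal ((cmod (?\<phi> x))\<^sup>2) \<partial>lborel) = (\<integral>\<^sup>+x. indicator {a..b} x \<partial>lborel)"
        by (intro nn_integral_cong) (auto simp: indicator_def)
      then show "(\<integral>\<^sup>+x. ennreal ((cmod (?\<phi> x))\<^sup>2) \<partial>lborel) < \<infinity>" using ab by simp
    qed (auto intro!: cont_int F continuous_fourier u)
    ultimately have "(LINT x|lborel. F x * ?\<phi> x) = (LINT x|lborel. fourier g x * ?\<phi> x)"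
      by (rule LIMSEQ_unique[symmetric])
    then have "(LINT x|lborel. D x * ?\<phi> x) = 0"
      using cont_int[OF F] cont_int[OF continuous_fourier[OF g]]
      by (simp add: D_def left_diff_distrib)
    also have "(\<lambda>x. D x * ?\<phi> x) = (\<lambda>x. indicator {a..b} x *\<^sub>R D x)"
      by (auto simp: indicator_def)
    finally have "(LINT x:{a..b}|lborel. D x) = 0" by (simp add: set_lebesgue_integral_def)
    then show ?thesis
      using set_borel_integral_eq_integral(2)[OF borel_integrable_atLeastAtMost'[OF contD]] by simp
  qed
  have "D x = 0" for x
  proof -
    have "((\<lambda>y. integral {x..y} D) has_vector_derivative D x) (at x within {x..x + 1})"
      by (rule integral_has_vector_derivative[OF contD]) simp
    then have 1: "((\<lambda>y. 0) has_vector_derivative D x) (at x within {x..x + 1})"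
      by (rule has_vector_derivative_transform[rotated 2]) (simp_all add: zero)
    have 2: "((\<lambda>y. 0) has_vector_derivative 0) (at x within {x..x + 1})"
      by (rule has_vector_derivative_const)
    show ?thesis
      by (rule vector_derivative_unique_within[OF _ 1 2]) (simp add: trivial_limit_within)
  qed
  then show ?thesis by (simp add: D_def fun_eq_iff)
qed

section \<open>Continuous eigenfunctions in the Wiener space\<close>

text \<open>On each cell the essential supremum bounds the continuous function \<open>g\<close> at every point: a closed
  condition that holds almost everywhere on an open interval holds on its closure.\<close>

lemma wiener_space_majorant:
  assumes g: "g \<in> wiener_space" and cont: "continuous_on UNIV g"
  shows "\<exists>A. wiener_majorant A g"
proof -
  define M where "M k = esssup (restrict_space lborel {0..1}) (\<lambda>x. ennreal (cmod (g (x + of_int k))))" for k :: int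
  define A where "A k = enn2real (M k)" for k
  have fin: "(\<Sum>\<^sub>\<infinity>k. M k) < \<infinity>"
    using g by (simp add: wiener_space_def M_def)
  have sum_M: "sum M X \<le> (\<Sum>\<^sub>\<infinity>k. M k)" if "finite X" for X
    using that by (subst nonneg_infsum_complete) (auto intro: SUP_upper)
  have M_A: "M k = ennreal (A k)" for k
  proof -
    have "M k < \<infinity>" using sum_M[of "{k}"] fin by (simp add: order_le_less_trans)
    then show ?thesis by (simp add: A_def)
  qed
  have A0: "A k \<ge> 0" for k
    by (simp add: A_def)
  have "A summable_on UNIV"
  proof (rule nonneg_bdd_above_summable_on)
    show "bdd_above (sum A ` {F. F \<subseteq> UNIV \<and> finite F})"
    proof (rule bdd_aboveI2)
      fix X assume "X \<in> {F :: int set. F \<subseteq> UNIV \<and> finite F}"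
      then have "ennreal (sum A X) \<le> (\<Sum>\<^sub>\<infinity>k. M k)"
        using sum_M[of X] by (simp add: M_A A0)
      also have "\<dots> = ennreal (enn2real (\<Sum>\<^sub>\<infinity>k. M k))"
        using fin by simp
      finally show "sum A X \<le> enn2real (\<Sum>\<^sub>\<infinity>k. M k)"
        by (simp add: ennreal_le_iff)
    qed
  qed (rule A0)
  moreover have "cmod (g (t + of_int k)) \<le> A k" if t: "t \<in> {0..1}" for t k
  proof -
    define C where "C = {x. cmod (g (x + of_int k)) \<le> A k}"
    have closed: "closed C"
      unfolding C_def by (intro closed_Collect_le continuous_intros continuous_on_compose2[OF cont]) auto
    have "AE x in restrict_space lborel {0..1}. ennreal (cmod (g (x + of_int k))) \<le> M k"
      unfolding M_def by (rule esssup_AE)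
    then have "AE x in restrict_space lborel {0..1}. x \<in> C"
      by (simp add: M_A C_def A0)
    then have "AE x in lborel. x \<in> {0..1} \<longrightarrow> x \<in> C"
      by (subst (asm) AE_restrict_space_iff) auto
    then have "AE x in lborel. x \<in> {0<..<1} \<longrightarrow> x \<in> C"
      by eventually_elim auto
    then have "AE x\<in>{0<..<1} in lebesgue. x \<in> C"
      by (rule AE_completion)
    then have "{0<..<1} \<subseteq> C"
      using mem_closed_if_AE_lebesgue_open[OF open_greaterThanLessThan closed] by blast
    then have "closure {0<..<1} \<subseteq> C" using closed by (rule closure_minimal)
    then show ?thesis using t by (auto simp: C_def)
  qed
  ultimately show ?thesis by (auto simp: wiener_majorant_def)
qed

text \<open>The pointwise form of membership in the eigenspace and in the Wiener space, for the continuous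
  representative and the Fourier integral.\<close>

definition fourier_eigenfunction :: "nat \<Rightarrow> (real \<Rightarrow> complex) \<Rightarrow> bool" where
  "fourier_eigenfunction l g \<longleftrightarrow>
     (\<exists>A. wiener_majorant A g) \<and> continuous_on UNIV g \<and> fourier g = (\<lambda>x. (- \<i>) ^ l * g x)"

lemma fourier_eigenfunctionI:
  assumes "g \<in> fourier_eigenspace l \<inter> wiener_space" and cont: "continuous_on UNIV g"
  shows "fourier_eigenfunction l g"
proof -
  obtain A where A: "wiener_majorant A g"
    using wiener_space_majorant assms by blast
  have "fourier g = (\<lambda>x. (- \<i>) ^ l * g x)"
    by (rule fourier_eq_L2_fourier[OF integrable_wiener[OF cont A]])
       (use assms in \<open>auto simp: fourier_eigenspace_def intro!: continuous_intros\<close>)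
  then show ?thesis using A cont by (auto simp: fourier_eigenfunction_def)
qed

section \<open>Symmetries of the Zak transform of an eigenfunction\<close>

lemma zak_eigenfunction:
  assumes g: "fourier_eigenfunction l g" and T: "T > 0"
  shows "zak T g x \<gamma> = (- \<i>) ^ l * cis (2 * pi * x * \<gamma>) * zak (1 / T) g \<gamma> (- x)"
proof -
  obtain A where A: "wiener_majorant A g" and cont: "continuous_on UNIV g"
    and eig: "fourier g = (\<lambda>x. (- \<i>) ^ l * g x)"
    using g by (auto simp: fourier_eigenfunction_def)
  have A': "wiener_majorant A (fourier g)"
    using A by (simp add: wiener_majorant_def eig norm_mult norm_power)
  have "zak (1 / T) (fourier g) \<gamma> (- x) = (- \<i>) ^ l * zak (1 / T) g \<gamma> (- x)"
    by (simp add: zak_eq_cis eig mult.assoc infsum_cmult_right' mult.left_commute)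
  then show ?thesis
    using zak_fourier[OF cont A A' T, of x \<gamma>] by (simp add: mult_ac)
qed

text \<open>Two applications of the previous lemma: the phases cancel and the eigenvalue is squared.\<close>

lemma zak_eigenfunction_minus:
  assumes g: "fourier_eigenfunction l g" and T: "T > 0"
  shows "zak T g x \<gamma> = (- 1) ^ l * zak T g (- x) (- \<gamma>)"
proof -
  have "zak T g x \<gamma> = ((- \<i>) ^ l * (- \<i>) ^ l) * (cis (2 * pi * x * \<gamma>) * cis (2 * pi * \<gamma> * (- x))) * zak T g (- x) (- \<gamma>)"
    using zak_eigenfunction[OF g T, of x \<gamma>] zak_eigenfunction[OF g, of "1 / T" \<gamma> "- x"] T
    by (simp add: mult_ac)
  also have "(- \<i>) ^ l * (- \<i>) ^ l = (- 1) ^ l"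
    by (simp flip: power_mult_distrib)
  finally show ?thesis by (simp add: cis_mult mult_ac)
qed

text \<open>Quasi-periodicity in \<open>x\<close> contributes the sign \<open>e(1/2) = -1\<close>, and periodicity in the frequency
  identifies \<open>-1/2\<close> with \<open>1/2\<close>.\<close>

lemma zak_eigenfunction_reflect:
  assumes g: "fourier_eigenfunction l g" and T: "T > 0"
  shows "zak T g (1 - x) (1/2) = - ((- 1) ^ l * zak T g x (1/2))"
proof -
  have "zak T g (1 - x) (1/2) = - zak T g (- x) (1/2)"
    using zak_add_one_left[of T g "- x" "1/2"] by simp
  also have "zak T g (- x) (1/2) = zak T g (- x) (- (1/2))"
    using zak_add_int_right[of T g "- x" "- (1/2)" 1] by simp
  also have "\<dots> = (- 1) ^ l * zak T g x (1/2)"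
    using zak_eigenfunction_minus[OF g T, of "- x" "- (1/2)"] by simp
  finally show ?thesis by simp
qed

text \<open>The passage to scale \<open>1 / (s a)\<close> followed by decimation by \<open>n = s\<^sup>2\<close> lands at scale
  \<open>n / (s a) = s / a\<close>. With \<open>x\<^sub>p = (1/2 + p) / n\<close> the frequency becomes \<open>n (-x\<^sub>p) = -1/2 - p\<close>, which is \<open>1/2\<close> modulo \<open>1\<close>.\<close>

lemma zak_eigenfunction_finite_transform:
  fixes p :: nat
  assumes g: "fourier_eigenfunction l g" and "s > 0" "a > 0" and s: "s\<^sup>2 = real n" and n: "n > 0"
  shows "zak (s * a) g ((1/2 + real p) / real n) (1/2) = (- \<i>) ^ l * of_real (1 / s) *
    (\<Sum>q<n. cis (2 * pi * (1/2 + real q) * (1/2 + real p) / real n) * zak (s / a) g ((1/2 + real q) / real n) (1/2))"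
proof -
  define x where "x = (1/2 + real p) / real n"
  obtain A where A: "wiener_majorant A g" using g by (auto simp: fourier_eigenfunction_def)
  \<comment> \<open>scale and frequency after decimation of the series at scale \<open>1 / (s a)\<close>\<close>
  have na: "real n * (1 / (s * a)) = s / a"
    using assms by (simp add: power2_eq_square flip: s)
  have nx: "real n * (- x) = - (1 + of_int (int p)) + 1 / 2"
    using n by (simp add: x_def)
  have half: "zak b g y (real n * (- x)) = zak b g y (1/2)" for b y
    using zak_add_int_right[of b g y "1/2" "- (1 + int p)"] unfolding nx by (simp add: add.commute)
  have "sqrt (real n) = s" using assms(2) by (simp flip: s)
  then have "zak (1 / (s * a)) g (1/2) (- x) = of_real (1 / s) *
      (\<Sum>q<n. cis (- 2 * pi * real q * (- x)) * zak (s / a) g ((1/2 + real q) / real n) (1/2))"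
    using zak_decimation[OF A _ n, of "1 / (s * a)" "1/2" "- x"] assms(2,3) unfolding na half by simp
  then have "cis (2 * pi * x * (1/2)) * zak (1 / (s * a)) g (1/2) (- x) = of_real (1 / s) *
      (\<Sum>q<n. (cis (2 * pi * x * (1/2)) * cis (- 2 * pi * real q * (- x))) *
        zak (s / a) g ((1/2 + real q) / real n) (1/2))"
    by (simp only: sum_distrib_left mult_ac)
  moreover have "cis (2 * pi * x * (1/2)) * cis (- 2 * pi * real q * (- x))
      = cis (2 * pi * (1/2 + real q) * (1/2 + real p) / real n)" for q
    unfolding cis_mult by (rule arg_cong[where f=cis]) (simp add: x_def algebra_simps add_divide_distrib)
  ultimately have "cis (2 * pi * x * (1/2)) * zak (1 / (s * a)) g (1/2) (- x) = of_real (1 / s) *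
      (\<Sum>q<n. cis (2 * pi * (1/2 + real q) * (1/2 + real p) / real n) * zak (s / a) g ((1/2 + real q) / real n) (1/2))"
    by (simp only:)
  then show ?thesis
    using zak_eigenfunction[OF g, of "s * a" x "1/2"] assms(2,3) by (simp add: x_def mult.assoc)
qed

text \<open>Reflection makes the second entry \<open>- (-1)\<^sup>l\<close> times the first, so the transform of length \<open>2\<close> acts
  on the first entry as \<open>(-\<i>)\<^sup>l (e(1/8) - (-1)\<^sup>l e(3/8)) / \<surd>2\<close>. The bracket is \<open>\<surd>2\<close> for even \<open>l\<close> and
  \<open>\<surd>2 \<i>\<close> for odd \<open>l\<close>.\<close>

lemma zak_eigenfunction_sqrt2:
  fixes p :: nat
  assumes "s > 0" and s2: "s\<^sup>2 = 2" and l: "l \<in> {0, 1, 2, 3}" and g: "fourier_eigenfunction l g"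
    and a: "a > 0" and p: "real p \<le> s\<^sup>2 - 1"
  shows "zak (s * a) g ((1/2 + real p) / s\<^sup>2) (1/2)
    = (-1) ^ (l div 2) * zak (s / a) g ((1/2 + real p) / s\<^sup>2) (1/2)"
proof -
  have s: "s = sqrt 2" using s2 \<open>s > 0\<close> by (metis abs_of_pos real_sqrt_abs)
  have reflect: "zak b g (3/4) (1/2) = - ((- 1) ^ l * zak b g (1/4) (1/2))" if "b > 0" for b
    using zak_eigenfunction_reflect[OF g that, of "1/4"] by simp
  have cis1: "cis (pi / 4) = of_real (1 / sqrt 2) * (1 + \<i>)"
    by (simp add: complex_eq_iff cos_45 sin_45 real_div_sqrt field_simps)
  have "cis (pi * 3 / 4) = cis (pi / 4) * cis (pi / 2)"
    unfolding cis_mult by (rule arg_cong[where f=cis]) simp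
  then have cis3: "cis (pi * 3 / 4) = of_real (1 / sqrt 2) * (\<i> - 1)"
    unfolding cis1 by (simp add: algebra_simps)
  have ss: "of_real (1 / s) * (of_real (1 / sqrt 2) * z) = z / 2" for z :: complex
    unfolding s by (simp add: mult.assoc[symmetric] flip: of_real_mult)
  define Z where "Z = zak (s / a) g (1/4) (1/2)"
  have "zak (s * a) g (1/4) (1/2) = (- \<i>) ^ l * of_real (1 / s) * (cis (pi / 4) * Z + cis (pi * 3 / 4) * (- ((- 1) ^ l * Z)))"
    using zak_eigenfunction_finite_transform[OF g \<open>s > 0\<close> a, of 2 0] s2 reflect[of "s / a"] \<open>s > 0\<close> a
    by (simp add: numeral_2_eq_2 lessThan_Suc Z_def)
  also have "\<dots> = (- \<i>) ^ l * (((1 + \<i>) * Z + (\<i> - 1) * (- ((- 1) ^ l * Z))) / 2)"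
  proof -
    have "of_real (1 / s) * (cis (pi / 4) * Z + cis (pi * 3 / 4) * W)
        = of_real (1 / s) * (of_real (1 / sqrt 2) * ((1 + \<i>) * Z + (\<i> - 1) * W))" for W
      unfolding cis1 cis3 by (simp only: mult.assoc flip: distrib_left)
    then show ?thesis by (simp only: ss mult.assoc)
  qed
  also have "\<dots> = (-1) ^ (l div 2) * Z"
    using l by (auto simp: power3_eq_cube algebra_simps)
  finally have zero: "zak (s * a) g (1/4) (1/2) = (-1) ^ (l div 2) * zak (s / a) g (1/4) (1/2)"
    unfolding Z_def .
  have "p \<le> 1" using p s2 by simp
  then consider "p = 0" | "p = 1" by linarith
  then show ?thesis
  proof cases
    case 1
    then show ?thesis using zero s2 by simp
  next
    case 2
    then show ?thesis using zero s2 reflect[of "s * a"] reflect[of "s / a"] \<open>s > 0\<close> a by simp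
  qed
qed

text \<open>For even \<open>l\<close> reflection kills the middle entry and makes the last one the negative of the first,
  so the transform of length \<open>3\<close> acts on the first entry as \<open>(-\<i>)\<^sup>l (e(1/12) - e(5/12)) / \<surd>3\<close>. The
  bracket is \<open>2 cos (\<pi>/6) = \<surd>3\<close>.\<close>

lemma zak_eigenfunction_sqrt3:
  fixes p :: nat
  assumes "s > 0" and s2: "s\<^sup>2 = 3" and l: "l \<in> {0, 2}" and g: "fourier_eigenfunction l g"
    and a: "a > 0" and p: "real p \<le> s\<^sup>2 - 1"
  shows "zak (s * a) g ((1/2 + real p) / s\<^sup>2) (1/2)
    = (-1) ^ (l div 2) * zak (s / a) g ((1/2 + real p) / s\<^sup>2) (1/2)"
proof -
  have s: "s = sqrt 3" using s2 \<open>s > 0\<close> by (metis abs_of_pos real_sqrt_abs)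
  have reflect: "zak b g (5/6) (1/2) = - zak b g (1/6) (1/2)" "zak b g (1/2) (1/2) = 0" if "b > 0" for b
    using zak_eigenfunction_reflect[OF g that, of "1/6"] zak_eigenfunction_reflect[OF g that, of "1/2"] l
    by auto
  define Z where "Z = zak (s / a) g (1/6) (1/2)"
  have "zak (s * a) g (1/6) (1/2) = (- \<i>) ^ l * of_real (1 / s) * (cis (pi / 6) * Z - cis (pi * 5 / 6) * Z)"
    using zak_eigenfunction_finite_transform[OF g \<open>s > 0\<close> a, of 3 0] s2 reflect[of "s / a"] \<open>s > 0\<close> a
    by (simp add: numeral_3_eq_3 lessThan_Suc Z_def)
  also have "cis (pi / 6) * Z - cis (pi * 5 / 6) * Z = of_real s * Z"
  proof -
    have "- cis (- (pi / 6)) = cis (pi * 5 / 6)"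
      unfolding minus_cis by (rule arg_cong[where f=cis]) simp
    then have "cis (pi / 6) - cis (pi * 5 / 6) = cis (pi / 6) + cis (- (pi / 6))"
      by (metis diff_minus_eq_add)
    also have "\<dots> = of_real s"
      unfolding s by (simp add: complex_eq_iff cos_30)
    finally have "cis (pi / 6) - cis (pi * 5 / 6) = of_real s" .
    then show ?thesis by (simp only: left_diff_distrib[symmetric])
  qed
  also have "(- \<i>) ^ l * of_real (1 / s) * (of_real s * Z) = (-1) ^ (l div 2) * Z"
    using l \<open>s > 0\<close> by auto
  finally have zero: "zak (s * a) g (1/6) (1/2) = (-1) ^ (l div 2) * zak (s / a) g (1/6) (1/2)"
    unfolding Z_def .
  have "p \<le> 2" using p s2 by simp
  then consider "p = 0" | "p = 1" | "p = 2" by linarith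
  then show ?thesis
  proof cases
    case 1
    then show ?thesis using zero s2 by simp
  next
    case 2
    then show ?thesis using s2 reflect[of "s * a"] reflect[of "s / a"] \<open>s > 0\<close> a by simp
  next
    case 3
    then show ?thesis using zero s2 reflect[of "s * a"] reflect[of "s / a"] \<open>s > 0\<close> a by simp
  qed
qed

theorem theorem4p6:
  fixes s :: real
  assumes "s > 0" and "s\<^sup>2 \<in> {2, 3}"
  shows "(\<forall>l\<in>{0, 2::nat}. \<forall>g \<in> fourier_eigenspace l \<inter> wiener_space. continuous_on UNIV g \<longrightarrow>
            (\<forall>a>0. \<forall>p::nat. real p \<le> s\<^sup>2 - 1 \<longrightarrow>
               zak (s * a) g ((1/2 + real p) / s\<^sup>2) (1/2)
                 = (-1) ^ (l div 2) * zak (s / a) g ((1/2 + real p) / s\<^sup>2) (1/2)))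
       \<and> (s\<^sup>2 = 2 \<longrightarrow>
          (\<forall>l\<in>{1, 3::nat}. \<forall>g \<in> fourier_eigenspace l \<inter> wiener_space. continuous_on UNIV g \<longrightarrow>
            (\<forall>a>0. \<forall>p::nat. real p \<le> s\<^sup>2 - 1 \<longrightarrow>
               zak (s * a) g ((1/2 + real p) / s\<^sup>2) (1/2)
                 = (-1) ^ (l div 2) * zak (s / a) g ((1/2 + real p) / s\<^sup>2) (1/2))))"
  using assms(2) zak_eigenfunction_sqrt2[OF assms(1)] zak_eigenfunction_sqrt3[OF assms(1)] fourier_eigenfunctionI
  by fastforce

end
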